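(* Let $G=(V,E_G,\mathbf{w}^G,\boldsymbol{\mu})$ be a weighted hypergraph equipped with monotone submodular cut functions $\delta_h(S)=\min\{F_h(S),F_h(h\setminus S)\}$, $h\in E_G$ (each $F_h$ non-decreasing submodular on $2^h$ with $F_h(\emptyset)=0$ and $F_h(\{i\})>0$ for $i\in h$), and let $H=(V,E_H,\mathbf{w}^H)$ be a weighted graph. If $H\preceq_\rho G$, then for all $\mathbf{x}\in\mathbb{R}^V$, $$\sum_{\{i,j\}\in E_H}w^H_{ij}|x_i-x_j|\le\rho\cdot\sum_{h\in E_G}w^G_h\min_{u\in\mathbb{R}}\|\mathbf{x}_h-u\mathbf{1}\|_{F_h},$$ where $\mathbf{x}_h$ is the restriction of $\mathbf{x}$ to $h$. In particular, $\delta_H(S)\le\rho\cdot\delta_G(S)$ for all $S\subseteq V$, where $\delta_H(S)$ is the total weight of edges of $H$ crossing $S$ and $\delta_G(S)=\sum_{h\in E_G}w^G_h\delta_h(S\cap h)$.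
   Context: For non-decreasing submodular $F$ with $F(\emptyset)=0$, $F(\{i\})>0$: $\|\mathbf{x}\|_F=\bar F(|\mathbf{x}|)$ where $\bar F$ is the Lovász extension ($\bar F(\mathbf{x})=\max\{\langle\mathbf{x},\mathbf{y}\rangle:\langle\mathbf{y},\mathbf{1}\rangle=F(h),\ \langle\mathbf{y},\mathbf{1}^S\rangle\le F(S)\ \forall S\}$), and $\|\mathbf{y}\|_{*,F}=\max\{\langle\mathbf{y},\mathbf{x}\rangle:\|\mathbf{x}\|_F\le1\}$ is its dual norm. A hypergraph flow is $\mathbf{Y}=(\mathbf{y}_h)_{h\in E_G}$ with $\mathbf{y}_h\in\mathbb{R}^h$, $\langle\mathbf{y}_h,\mathbf{1}\rangle=0$; its demand vector is $\mathrm{dem}_i(\mathbf{Y})=\sum_{h\ni i}(\mathbf{y}_h)_i$. $H\preceq_\rho G$ ($H$ embeds into $G$ as a flow with congestion $\rho\ge0$) means there are hypergraph flows $\{\mathbf{Y}^e\}_{e\in E_H}$ such that (1) for every $e=\{i,j\}\in E_H$, $|\mathrm{dem}(\mathbf{Y}^e)|=w^H_e(\mathbf{1}_i+\mathbf{1}_j)$ (entrywise absolute value), and (2) for every $h\in E_G$, $\big\|\sum_{e\in E_H}|\mathbf{y}^e_h|\big\|_{*,F_h}\le\rho\,w^G_h$. *)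

theory Defs
  imports "HOL-Analysis.Analysis"
begin

text \<open>
  The common vertex set \<open>V\<close> is the universe of a finite type \<open>'v\<close>.  For a set \<open>h\<close> of vertices, the
  space \<open>\<real>\<^sup>h\<close> is identified with the vectors of \<open>\<real>\<^sup>V\<close> that vanish outside \<open>h\<close>; the inner product
  of \<open>\<real>\<^sup>V\<close> then restricts to that of \<open>\<real>\<^sup>h\<close>.  The absolute value on \<open>real ^ 'v\<close> is
  the entrywise one.  All maxima and minima are written with \<open>GREATEST\<close> and \<open>LEAST\<close>, that is, as
  attained extrema and not as suprema or infima.
\<close>

definition vecs_on :: "'v::finite set \<Rightarrow> (real ^ 'v) set" where
  "vecs_on h = {x. \<forall>i. i \<notin> h \<longrightarrow> x $ i = 0}"

definition ind_vec :: "'v::finite set \<Rightarrow> real ^ 'v" where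
  "ind_vec S = (\<chi> i. if i \<in> S then 1 else 0)"

definition restrict_vec :: "'v::finite set \<Rightarrow> real ^ 'v \<Rightarrow> real ^ 'v" where
  "restrict_vec h x = (\<chi> i. if i \<in> h then x $ i else 0)"

definition monotone_submodular :: "'v set \<Rightarrow> ('v set \<Rightarrow> real) \<Rightarrow> bool" where
  "monotone_submodular h F \<longleftrightarrow>
     F {} = 0 \<and> (\<forall>i\<in>h. F {i} > 0) \<and>
     (\<forall>S T. S \<subseteq> T \<and> T \<subseteq> h \<longrightarrow> F S \<le> F T) \<and>
     (\<forall>S T. S \<subseteq> h \<and> T \<subseteq> h \<longrightarrow> F (S \<union> T) + F (S \<inter> T) \<le> F S + F T)"

definition base_polytope :: "'v::finite set \<Rightarrow> ('v set \<Rightarrow> real) \<Rightarrow> (real ^ 'v) set" where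
  "base_polytope h F =
     {y \<in> vecs_on h. y \<bullet> ind_vec h = F h \<and> (\<forall>S\<subseteq>h. y \<bullet> ind_vec S \<le> F S)}"

definition lovasz :: "'v::finite set \<Rightarrow> ('v set \<Rightarrow> real) \<Rightarrow> real ^ 'v \<Rightarrow> real" where
  "lovasz h F x = (GREATEST r. r \<in> (\<lambda>y. x \<bullet> y) ` base_polytope h F)"

definition submod_norm :: "'v::finite set \<Rightarrow> ('v set \<Rightarrow> real) \<Rightarrow> real ^ 'v \<Rightarrow> real" where
  "submod_norm h F x = lovasz h F \<bar>x\<bar>"

definition dual_norm :: "'v::finite set \<Rightarrow> ('v set \<Rightarrow> real) \<Rightarrow> real ^ 'v \<Rightarrow> real" where
  "dual_norm h F y =
     (GREATEST r. r \<in> (\<lambda>x. y \<bullet> x) ` {x \<in> vecs_on h. submod_norm h F x \<le> 1})"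

definition min_submod_norm :: "'v::finite set \<Rightarrow> ('v set \<Rightarrow> real) \<Rightarrow> real ^ 'v \<Rightarrow> real" where
  "min_submod_norm h F x =
     (LEAST r. r \<in> range (\<lambda>u. submod_norm h F (restrict_vec h x - u *\<^sub>R ind_vec h)))"

record 'v weighted_hypergraph =
  hyperedges :: "'v set set"
  hweight :: "'v set \<Rightarrow> real"
  vweight :: "'v \<Rightarrow> real"
  cut_gen :: "'v set \<Rightarrow> 'v set \<Rightarrow> real"  \<comment> \<open>the function \<open>F\<^sub>h\<close> generating the cut function \<open>\<delta>\<^sub>h\<close>\<close>

definition monotone_submodular_hypergraph :: "('v::finite) weighted_hypergraph \<Rightarrow> bool" where
  "monotone_submodular_hypergraph G \<longleftrightarrow>
     (\<forall>h\<in>hyperedges G. hweight G h \<ge> 0) \<and> (\<forall>i. vweight G i \<ge> 0) \<and>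
     (\<forall>h\<in>hyperedges G. monotone_submodular h (cut_gen G h))"

definition hyperedge_cut :: "'v weighted_hypergraph \<Rightarrow> 'v set \<Rightarrow> 'v set \<Rightarrow> real" where
  "hyperedge_cut G h S = min (cut_gen G h S) (cut_gen G h (h - S))"

definition hypergraph_cut :: "'v weighted_hypergraph \<Rightarrow> 'v set \<Rightarrow> real" where
  "hypergraph_cut G S = (\<Sum>h\<in>hyperedges G. hweight G h * hyperedge_cut G h (S \<inter> h))"

record 'v weighted_graph =
  edges :: "'v set set"
  eweight :: "'v set \<Rightarrow> real"

definition is_weighted_graph :: "('v::finite) weighted_graph \<Rightarrow> bool" where
  "is_weighted_graph H \<longleftrightarrow> (\<forall>e\<in>edges H. card e = 2 \<and> eweight H e \<ge> 0)"

definition graph_cut :: "'v weighted_graph \<Rightarrow> 'v set \<Rightarrow> real" where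
  "graph_cut H S = (\<Sum>e | e \<in> edges H \<and> e \<inter> S \<noteq> {} \<and> e - S \<noteq> {}. eweight H e)"

definition edge_diff :: "real ^ 'v::finite \<Rightarrow> 'v set \<Rightarrow> real" where
  "edge_diff x e = (THE d. \<exists>i j. e = {i, j} \<and> d = \<bar>x $ i - x $ j\<bar>)"

lemma edge_diff_pair: "edge_diff x {i, j} = \<bar>x $ i - x $ j\<bar>"
  unfolding edge_diff_def
  by (rule the_equality) (auto simp: doubleton_eq_iff)

text \<open>Only the values of a flow on the hyperedges of the hypergraph matter.\<close>

definition hypergraph_flow ::
    "('v::finite) weighted_hypergraph \<Rightarrow> ('v set \<Rightarrow> real ^ 'v) \<Rightarrow> bool" where
  "hypergraph_flow G Y \<longleftrightarrow>
     (\<forall>h\<in>hyperedges G. Y h \<in> vecs_on h \<and> Y h \<bullet> ind_vec h = 0)"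

definition dem :: "('v::finite) weighted_hypergraph \<Rightarrow> ('v set \<Rightarrow> real ^ 'v) \<Rightarrow> real ^ 'v" where
  "dem G Y = (\<chi> i. \<Sum>h | h \<in> hyperedges G \<and> i \<in> h. Y h $ i)"

definition flow_embeds ::
    "('v::finite) weighted_graph \<Rightarrow> real \<Rightarrow> 'v weighted_hypergraph \<Rightarrow> bool" where
  "flow_embeds H \<rho> G \<longleftrightarrow> \<rho> \<ge> 0 \<and>
     (\<exists>Y :: 'v set \<Rightarrow> 'v set \<Rightarrow> real ^ 'v.
        (\<forall>e\<in>edges H. hypergraph_flow G (Y e)) \<and>
        (\<forall>e\<in>edges H. \<forall>i j. e = {i, j} \<longrightarrow>
           \<bar>dem G (Y e)\<bar> = eweight H e *\<^sub>R (ind_vec {i} + ind_vec {j})) \<and>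
        (\<forall>h\<in>hyperedges G.
           dual_norm h (cut_gen G h) (\<Sum>e\<in>edges H. \<bar>Y e h\<bar>) \<le> \<rho> * hweight G h))"

end

theory Submission
  imports Defs
begin

text \<open>
  Orient each demand as \<open>\<plusminus>w\<^sub>e(\<one>\<^sub>i - \<one>\<^sub>j)\<close>, which is forced because every flow sums to zero.  Then
  \<open>w\<^sub>e \<bar>x\<^sub>i - x\<^sub>j\<bar> = \<bar>\<langle>x, dem Y\<^sup>e\<rangle>\<bar> \<le> \<Sum>\<^sub>h \<langle>\<bar>x\<^sub>h - u\<^sub>h \<one>\<bar>, \<bar>y\<^sup>e\<^sub>h\<bar>\<rangle>\<close> for arbitrary shifts \<open>u\<^sub>h\<close>; summing over
  \<open>e\<close> and applying the inequality \<open>\<langle>z, x\<rangle> \<le> \<parallel>x\<parallel>\<^sub>F \<parallel>z\<parallel>\<^sub>*\<^sub>,\<^sub>F\<close> on each hyperedge gives the bound.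
  The extrema are attained by compactness; the unit ball is bounded because, by the greedy
  algorithm, some base attains \<open>y\<^sub>i = F{i} > 0\<close>, and bases are nonnegative by monotonicity.
\<close>

section \<open>Entrywise access to vectors\<close>

lemma abs_vec_nth [simp]: "\<bar>x :: real ^ 'n::finite\<bar> $ i = \<bar>x $ i\<bar>"
  by (simp add: abs_vec_def)

lemma ind_vec_nth [simp]: "ind_vec S $ i = (if i \<in> S then 1 else 0)"
  by (simp add: ind_vec_def)

lemma restrict_vec_nth [simp]: "restrict_vec h x $ i = (if i \<in> h then x $ i else 0)"
  by (simp add: restrict_vec_def)

lemma vecs_onD: "x \<in> vecs_on h \<Longrightarrow> i \<notin> h \<Longrightarrow> x $ i = 0"
  by (simp add: vecs_on_def)

lemma inner_ind_vec: "y \<bullet> ind_vec S = (\<Sum>i\<in>S. y $ i)"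
  by (simp add: inner_vec_def if_distrib sum.If_cases cong: if_cong)

section \<open>Submodular functions and greedy bases\<close>

lemma monotone_submodularD:
  assumes "monotone_submodular h F"
  shows "F {} = 0" "i \<in> h \<Longrightarrow> 0 < F {i}"
    and "S \<subseteq> T \<Longrightarrow> T \<subseteq> h \<Longrightarrow> F S \<le> F T"
    and "S \<subseteq> h \<Longrightarrow> T \<subseteq> h \<Longrightarrow> F (S \<union> T) + F (S \<inter> T) \<le> F S + F T"
  using assms by (auto simp: monotone_submodular_def)

lemma base_polytopeD:
  assumes "y \<in> base_polytope h F"
  shows "i \<notin> h \<Longrightarrow> y $ i = 0" "(\<Sum>i\<in>h. y $ i) = F h" "S \<subseteq> h \<Longrightarrow> (\<Sum>i\<in>S. y $ i) \<le> F S"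
  using assms by (auto simp: base_polytope_def vecs_on_def inner_ind_vec)

text \<open>One step of the greedy algorithm: the new element receives its marginal value over
  \<open>A\<close>, which makes the total exact, and submodularity keeps the constraints for sets
  containing \<open>a\<close>.\<close>

lemma base_polytope_insert:
  assumes F: "monotone_submodular (insert a A) F" and a: "a \<notin> A"
    and y: "y \<in> base_polytope A F"
  shows "y + (F (insert a A) - F A) *\<^sub>R axis a 1 \<in> base_polytope (insert a A) F"
    (is "?y \<in> _")
proof -
  have nth: "?y $ i = (if i = a then F (insert a A) - F A else y $ i)" for i
    using base_polytopeD(1)[OF y a] by (simp add: axis_def)
  have sum_A: "(\<Sum>i\<in>S. ?y $ i) = (\<Sum>i\<in>S. y $ i)" if "S \<subseteq> A" for S
    using that a by (intro sum.cong refl) (metis nth subsetD)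
  have "(\<Sum>i\<in>S. ?y $ i) \<le> F S" if S: "S \<subseteq> insert a A" for S
  proof (cases "a \<in> S")
    case False
    then have "S \<subseteq> A" using S by auto
    then show ?thesis using base_polytopeD(3)[OF y] sum_A by simp
  next
    case True
    define T where "T = S - {a}"
    have T: "S = insert a T" "a \<notin> T" "T \<subseteq> A" using True S by (auto simp: T_def)
    have "(\<Sum>i\<in>S. ?y $ i) = F (insert a A) - F A + (\<Sum>i\<in>T. y $ i)"
      using T sum_A[of T] nth[of a] by simp
    also have "\<dots> \<le> F (insert a A) - F A + F T"
      using base_polytopeD(3)[OF y T(3)] by simp
    also have "\<dots> \<le> F S"
    proof -
      \<comment> \<open>Submodularity for \<open>S\<close> and \<open>A\<close> says that the
        marginal value of \<open>a\<close> over \<open>A\<close> is at most its marginal value over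
        the smaller set \<open>T\<close>.\<close>
      have "S \<union> A = insert a A" "S \<inter> A = T" using T a by auto
      then show ?thesis
        using monotone_submodularD(4)[OF F S subset_insertI] by simp
    qed
    finally show ?thesis .
  qed
  moreover have "(\<Sum>i\<in>insert a A. ?y $ i) = F (insert a A)"
    using a sum_A[of A] nth[of a] base_polytopeD(2)[OF y] by simp
  moreover have "?y \<in> vecs_on (insert a A)"
    using base_polytopeD(1)[OF y] unfolding vecs_on_def by (auto simp: axis_def)
  ultimately show ?thesis
    unfolding base_polytope_def inner_ind_vec by blast
qed

lemma monotone_submodular_subset:
  "monotone_submodular h F \<Longrightarrow> A \<subseteq> h \<Longrightarrow> monotone_submodular A F"
  unfolding monotone_submodular_def by (meson order.trans subsetD)

lemma base_polytope_empty: "F {} = 0 \<Longrightarrow> 0 \<in> base_polytope {} F"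
  by (simp add: base_polytope_def vecs_on_def inner_ind_vec)

text \<open>Run the greedy algorithm with \<open>i\<close> first: starting from the zero base of the
  empty set, \<open>i\<close> receives \<open>F {i} - F {}\<close>, and later insertions leave this
  entry alone. Hence the induction runs over sets \<open>B\<close> avoiding
  \<open>i\<close>.\<close>

lemma exists_base_with_entry:
  assumes F: "monotone_submodular h F" and i: "i \<in> h"
  shows "\<exists>y\<in>base_polytope h F. y $ i = F {i}"
proof -
  have "\<exists>y\<in>base_polytope (insert i B) F. y $ i = F {i}" if "B \<subseteq> h - {i}" for B
    using finite[of B] that
  proof (induction B rule: finite_induct)
    case empty
    have "monotone_submodular {i} F"
      using monotone_submodular_subset[OF F] i by simp
    moreover have F0: "F {} = 0" by (rule monotone_submodularD(1)[OF F])
    ultimately have "0 + (F {i} - F {}) *\<^sub>R axis i 1 \<in> base_polytope {i} F"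
      by (intro base_polytope_insert base_polytope_empty) auto
    then show ?case by (rule bexI[rotated]) (simp add: F0 axis_def)
  next
    case (insert a B)
    then obtain y where y: "y \<in> base_polytope (insert i B) F" "y $ i = F {i}" by auto
    have *: "a \<notin> insert i B" using insert by auto
    have "monotone_submodular (insert a (insert i B)) F"
      using insert.prems i by (intro monotone_submodular_subset[OF F]) auto
    from base_polytope_insert[OF this * y(1)] y(2) * show ?case
      by (intro bexI[of _ "y + (F (insert a (insert i B)) - F (insert i B)) *\<^sub>R axis a 1"])
        (auto simp: axis_def insert_commute)
  qed
  from this[of "h - {i}"] i show ?thesis by (simp add: insert_absorb)
qed

lemma base_polytope_nonempty:
  assumes "monotone_submodular h F"
  shows "base_polytope h F \<noteq> {}"
proof (cases "h = {}")
  case True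
  then show ?thesis
    using base_polytope_empty monotone_submodularD(1)[OF assms] by auto
next
  case False
  then show ?thesis using exists_base_with_entry[OF assms] by blast
qed

text \<open>For \<open>i\<close> in \<open>h\<close>, the entry is \<open>F h\<close> minus the sum
  over \<open>h - {i}\<close>, hence at least \<open>F h - F (h - {i})\<close>, which is nonnegative
  by monotonicity.\<close>

lemma base_polytope_nonneg:
  assumes F: "monotone_submodular h F" and y: "y \<in> base_polytope h F"
  shows "0 \<le> y $ i"
proof (cases "i \<in> h")
  case True
  have "(\<Sum>j\<in>h - {i}. y $ j) \<le> F h"
    using base_polytopeD(3)[OF y, of "h - {i}"] monotone_submodularD(3)[OF F, of "h - {i}" h]
    by auto
  then show ?thesis
    using base_polytopeD(2)[OF y] sum.remove[OF _ True, of "\<lambda>j. y $ j"] by simp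
qed (simp add: base_polytopeD(1)[OF y])

section \<open>Compactness and attained maxima\<close>

lemma closed_vecs_on: "closed (vecs_on h)"
proof -
  have "vecs_on h = (\<Inter>i\<in>- h. {x. x $ i = 0})"
    by (auto simp: vecs_on_def)
  then show ?thesis
    by (auto intro!: closed_INT closed_Collect_eq continuous_intros)
qed

lemma compact_if_entries_bounded:
  fixes A :: "(real ^ 'n::finite) set"
  assumes "closed A" and "\<And>x i. x \<in> A \<Longrightarrow> \<bar>x $ i\<bar> \<le> b i"
  shows "compact A"
proof -
  have "norm x \<le> (\<Sum>i\<in>UNIV. b i)" if "x \<in> A" for x
    using norm_le_l1_cart[of x] sum_mono[of UNIV "\<lambda>i. \<bar>x $ i\<bar>" b] assms(2)[OF that]
    by (auto intro: order.trans)
  then show ?thesis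
    using assms(1) by (auto simp: compact_eq_bounded_closed bounded_iff)
qed

lemma compact_base_polytope:
  assumes F: "monotone_submodular h F"
  shows "compact (base_polytope h F)"
proof (rule compact_if_entries_bounded)
  have "base_polytope h F = vecs_on h \<inter> {y. y \<bullet> ind_vec h = F h} \<inter>
      (\<Inter>S\<in>Pow h. {y. y \<bullet> ind_vec S \<le> F S})"
    by (auto simp: base_polytope_def)
  then show "closed (base_polytope h F)"
    by (auto intro!: closed_Int closed_INT closed_vecs_on closed_Collect_eq closed_Collect_le
        continuous_intros)
next
  fix y i assume y: "y \<in> base_polytope h F"
  \<comment> \<open>The absolute value on the right covers \<open>i\<close> outside
    \<open>h\<close>, where the entry is 0 but the sign of \<open>F {i}\<close> is unknown.\<close>
  show "\<bar>y $ i\<bar> \<le> \<bar>F {i}\<bar>"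
    using base_polytope_nonneg[OF F y, of i] base_polytopeD(1)[OF y, of i]
      base_polytopeD(3)[OF y, of "{i}"]
    by (cases "i \<in> h") auto
qed

text \<open>\<open>GREATEST\<close> is meaningful only when the maximum is attained; compactness
  supplies the maximiser, so that it is both a value of \<open>f\<close> and an upper bound.\<close>

lemma Greatest_compact_image:
  fixes f :: "'a::topological_space \<Rightarrow> real"
  assumes "compact A" "A \<noteq> {}" "continuous_on A f"
  shows "(GREATEST r. r \<in> f ` A) \<in> f ` A" and "\<And>x. x \<in> A \<Longrightarrow> f x \<le> (GREATEST r. r \<in> f ` A)"
proof -
  obtain m where m: "m \<in> A" "\<And>x. x \<in> A \<Longrightarrow> f x \<le> f m"
    using continuous_attains_sup[OF assms] by blast
  then have "(GREATEST r. r \<in> f ` A) = f m"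
    by (intro Greatest_equality) auto
  with m show "(GREATEST r. r \<in> f ` A) \<in> f ` A"
    and "\<And>x. x \<in> A \<Longrightarrow> f x \<le> (GREATEST r. r \<in> f ` A)"
    by auto
qed

section \<open>The submodular norm and its dual\<close>

lemma submod_norm_upper:
  assumes "monotone_submodular h F" "y \<in> base_polytope h F"
  shows "\<bar>x\<bar> \<bullet> y \<le> submod_norm h F x"
  unfolding submod_norm_def lovasz_def using assms
  by (intro Greatest_compact_image(2)[where f = "\<lambda>y. \<bar>x\<bar> \<bullet> y"])
    (auto intro!: compact_base_polytope continuous_intros)

lemma submod_norm_attained:
  assumes "monotone_submodular h F"
  obtains y where "y \<in> base_polytope h F" "submod_norm h F x = \<bar>x\<bar> \<bullet> y"
proof -
  have "submod_norm h F x \<in> (\<lambda>y. \<bar>x\<bar> \<bullet> y) ` base_polytope h F"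
    unfolding submod_norm_def lovasz_def using assms
    by (intro Greatest_compact_image(1))
      (auto intro!: compact_base_polytope continuous_intros simp: base_polytope_nonempty)
  then show ?thesis using that by auto
qed

text \<open>Turns a norm bound into one inequality per base, which is how the closed unit ball and
  all later upper bounds are handled.\<close>

lemma submod_norm_le_iff:
  assumes "monotone_submodular h F"
  shows "submod_norm h F x \<le> r \<longleftrightarrow> (\<forall>y\<in>base_polytope h F. \<bar>x\<bar> \<bullet> y \<le> r)"
  using submod_norm_upper[OF assms] submod_norm_attained[OF assms]
  by (metis order.trans)

lemma submod_norm_abs [simp]: "submod_norm h F \<bar>x\<bar> = submod_norm h F x"
proof -
  have "\<bar>\<bar>x\<bar>\<bar> = \<bar>x\<bar>" by (simp add: vec_eq_iff)
  then show ?thesis by (simp add: submod_norm_def)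
qed

text \<open>Test against the greedy base with \<open>y $ i = F {i}\<close>; the other terms are
  nonnegative. As \<open>F {i} > 0\<close>, this yields definiteness on \<open>vecs_on h\<close> and
  boundedness of the unit ball.\<close>

lemma submod_norm_ge_entry:
  assumes F: "monotone_submodular h F" and i: "i \<in> h"
  shows "\<bar>x $ i\<bar> * F {i} \<le> submod_norm h F x"
proof -
  obtain y where y: "y \<in> base_polytope h F" "y $ i = F {i}"
    using exists_base_with_entry[OF F i] by blast
  have "\<bar>x $ i\<bar> * F {i} \<le> \<bar>x\<bar> \<bullet> y"
    using member_le_sum[of i UNIV "\<lambda>j. \<bar>x $ j\<bar> * y $ j"] base_polytope_nonneg[OF F y(1)] y(2)
    by (simp add: inner_vec_def)
  then show ?thesis using submod_norm_upper[OF F y(1)] order.trans by blast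
qed

lemma submod_norm_nonneg:
  assumes F: "monotone_submodular h F"
  shows "0 \<le> submod_norm h F x"
proof -
  obtain y where "y \<in> base_polytope h F" "submod_norm h F x = \<bar>x\<bar> \<bullet> y"
    using submod_norm_attained[OF F] .
  then show ?thesis
    using base_polytope_nonneg[OF F] by (auto simp: inner_vec_def intro!: sum_nonneg)
qed

text \<open>The bound for each base is exactly the polytope constraint for \<open>S\<close>.\<close>

lemma submod_norm_ind_vec_le:
  assumes F: "monotone_submodular h F" and "S \<subseteq> h"
  shows "submod_norm h F (ind_vec S) \<le> F S"
proof -
  have "\<bar>ind_vec S\<bar> = ind_vec S" by (simp add: vec_eq_iff)
  then show ?thesis
    using assms by (auto simp: submod_norm_le_iff inner_commute base_polytope_def)
qed

text \<open>Closed as an intersection over all bases of sublevel sets of weighted sums of absolute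
  values, so continuity of the norm itself is never invoked; bounded because the norm controls each
  entry in \<open>h\<close>.\<close>

lemma compact_submod_unit_ball:
  assumes F: "monotone_submodular h F"
  shows "compact {x \<in> vecs_on h. submod_norm h F x \<le> 1}"
proof (rule compact_if_entries_bounded)
  have "{x \<in> vecs_on h. submod_norm h F x \<le> 1} =
      vecs_on h \<inter> (\<Inter>y\<in>base_polytope h F. {x. (\<Sum>i\<in>UNIV. \<bar>x $ i\<bar> * y $ i) \<le> 1})"
    by (auto simp: submod_norm_le_iff[OF F] inner_vec_def)
  then show "closed {x \<in> vecs_on h. submod_norm h F x \<le> 1}"
    by (auto intro!: closed_Int closed_INT closed_vecs_on closed_Collect_le continuous_intros)
next
  fix x i assume x: "x \<in> {x \<in> vecs_on h. submod_norm h F x \<le> 1}"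
  show "\<bar>x $ i\<bar> \<le> \<bar>1 / F {i}\<bar>"
  proof (cases "i \<in> h")
    case True
    then show ?thesis
      using submod_norm_ge_entry[OF F True, of x] monotone_submodularD(2)[OF F True] x
      by (simp add: field_simps)
  next
    case False
    then show ?thesis using x vecs_onD[of x h i] by simp
  qed
qed

text \<open>Scale \<open>x\<close> to norm at most 1 and use that the dual norm is a maximum over
  the unit ball. When the norm is 0 scaling is impossible, but then every entry of \<open>x\<close>
  vanishes.\<close>

lemma inner_le_submod_norm_dual_norm:
  assumes F: "monotone_submodular h F" and x: "x \<in> vecs_on h"
  shows "z \<bullet> x \<le> submod_norm h F x * dual_norm h F z"
proof (cases "submod_norm h F x = 0")
  case True
  have "x $ i = 0" for i
  proof (cases "i \<in> h")
    case i: True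
    then show ?thesis
      using submod_norm_ge_entry[OF F i, of x] monotone_submodularD(2)[OF F i] True
      by (simp add: mult_le_0_iff)
  qed (rule vecs_onD[OF x])
  then have "x = 0" by (simp add: vec_eq_iff)
  then show ?thesis using True by simp
next
  case False
  let ?n = "submod_norm h F x"
  have n: "0 < ?n" using False submod_norm_nonneg[OF F, of x] by simp
  define x' where "x' = (1 / ?n) *\<^sub>R x"
  have "\<bar>x'\<bar> = (1 / ?n) *\<^sub>R \<bar>x\<bar>" using n by (simp add: x'_def vec_eq_iff abs_mult)
  then have "submod_norm h F x' \<le> 1"
    using submod_norm_upper[OF F, of _ x] n by (simp add: submod_norm_le_iff[OF F])
  moreover have "x' \<in> vecs_on h" using x by (simp add: x'_def vecs_on_def)
  ultimately have "z \<bullet> x' \<le> dual_norm h F z"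
    unfolding dual_norm_def
    by (intro Greatest_compact_image(2)[where f = "\<lambda>x. z \<bullet> x"] compact_submod_unit_ball[OF F])
      (auto intro!: continuous_intros)
  then show ?thesis using n by (simp add: x'_def field_simps)
qed

section \<open>The optimal shift of a vector\<close>

lemma submod_norm_shift_le:
  assumes F: "monotone_submodular h F"
  shows "submod_norm h F (x - u *\<^sub>R ind_vec h)
    \<le> submod_norm h F (x - v *\<^sub>R ind_vec h) + \<bar>u - v\<bar> * F h"
  unfolding submod_norm_le_iff[OF F]
proof
  fix y assume y: "y \<in> base_polytope h F"
  \<comment> \<open>Entrywise triangle inequality, weighted by the nonnegative entries of
    \<open>y\<close>. The shift acts only on \<open>h\<close>, where \<open>y\<close> sums to
    \<open>F h\<close>; this is the source of the constant.\<close>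
  have "\<bar>x - u *\<^sub>R ind_vec h\<bar> \<bullet> y
      \<le> (\<Sum>i\<in>UNIV. \<bar>x - v *\<^sub>R ind_vec h\<bar> $ i * y $ i + \<bar>u - v\<bar> * (y $ i * ind_vec h $ i))"
    unfolding inner_vec_def inner_real_def
  proof (rule sum_mono)
    fix i
    have "\<bar>x - u *\<^sub>R ind_vec h\<bar> $ i
        \<le> \<bar>x - v *\<^sub>R ind_vec h\<bar> $ i + \<bar>u - v\<bar> * ind_vec h $ i" by (simp, arith)
    from mult_right_mono[OF this base_polytope_nonneg[OF F y, of i]]
    show "\<bar>x - u *\<^sub>R ind_vec h\<bar> $ i * y $ i
      \<le> \<bar>x - v *\<^sub>R ind_vec h\<bar> $ i * y $ i + \<bar>u - v\<bar> * (y $ i * ind_vec h $ i)"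
      by (simp add: algebra_simps)
  qed
  also have "\<dots> = \<bar>x - v *\<^sub>R ind_vec h\<bar> \<bullet> y + \<bar>u - v\<bar> * (y \<bullet> ind_vec h)"
    by (simp add: inner_vec_def sum.distrib sum_distrib_left)
  also have "\<dots> \<le> submod_norm h F (x - v *\<^sub>R ind_vec h) + \<bar>u - v\<bar> * F h"
    using submod_norm_upper[OF F y] y by (simp add: base_polytope_def)
  finally show "\<bar>x - u *\<^sub>R ind_vec h\<bar> \<bullet> y
    \<le> submod_norm h F (x - v *\<^sub>R ind_vec h) + \<bar>u - v\<bar> * F h" .
qed

text \<open>As a function of the shift, the norm is Lipschitz with constant \<open>F h\<close>, and
  a single entry \<open>i\<close> in \<open>h\<close> already bounds every shift doing no worse than
  0. So the minimum is taken over a compact set.\<close>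

lemma min_submod_norm_attained:
  assumes F: "monotone_submodular h F"
  obtains u where
    "min_submod_norm h F x = submod_norm h F (restrict_vec h x - u *\<^sub>R ind_vec h)"
    "\<And>v. min_submod_norm h F x \<le> submod_norm h F (restrict_vec h x - v *\<^sub>R ind_vec h)"
proof -
  define f where "f u = submod_norm h F (restrict_vec h x - u *\<^sub>R ind_vec h)" for u
  have "\<exists>u. \<forall>v. f u \<le> f v"
  \<comment> \<open>For empty \<open>h\<close> the function \<open>f\<close> is constant, so its
    sublevel set is unbounded but any shift is a minimiser.\<close>
  proof (cases "h = {}")
    case True
    then have "ind_vec h = 0" by (simp add: vec_eq_iff)
    then show ?thesis by (simp add: f_def)
  next
    case False
    then obtain i where i: "i \<in> h" by auto
    have "F h \<ge> 0"
      using monotone_submodularD(1,3)[OF F] by (metis empty_subsetI order_refl)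
    moreover have "\<bar>f u - f v\<bar> \<le> F h * \<bar>u - v\<bar>" for u v
      using submod_norm_shift_le[OF F, of "restrict_vec h x" u v]
        submod_norm_shift_le[OF F, of "restrict_vec h x" v u]
      by (simp add: f_def abs_minus_commute mult.commute)
    ultimately have "(F h)-lipschitz_on UNIV f"
      by (auto intro!: lipschitz_onI simp: dist_real_def)
    then have cont: "continuous_on UNIV f"
      by (rule lipschitz_on_continuous_on)
    have Fi: "0 < F {i}" using monotone_submodularD(2)[OF F i] .
    have bound: "\<bar>u\<bar> \<le> \<bar>x $ i\<bar> + f 0 / F {i}" if "f u \<le> f 0" for u
    proof -
      have "\<bar>x $ i - u\<bar> * F {i} \<le> f 0"
        using submod_norm_ge_entry[OF F i, of "restrict_vec h x - u *\<^sub>R ind_vec h"] i that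
        by (simp add: f_def)
      then have "\<bar>x $ i - u\<bar> \<le> f 0 / F {i}" using Fi by (simp add: field_simps)
      then show ?thesis by linarith
    qed
    have "closed {u. f u \<le> f 0}"
      using cont by (intro closed_Collect_le continuous_intros)
    moreover have "bounded {u. f u \<le> f 0}"
      using bound by (auto simp: bounded_iff)
    ultimately have "compact {u. f u \<le> f 0}"
      by (simp add: compact_eq_bounded_closed)
    \<comment> \<open>A minimiser on the sublevel set is global: outside it the values exceed
      \<open>f 0\<close>.\<close>
    then obtain u where "f u \<le> f 0" "\<And>v. f v \<le> f 0 \<Longrightarrow> f u \<le> f v"
      using continuous_attains_inf[of "{u. f u \<le> f 0}" f] continuous_on_subset[OF cont] by blast
    then show ?thesis by (metis linear order.trans)
  qed
  then obtain u where u: "\<And>v. f u \<le> f v" by blast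
  have "min_submod_norm h F x = f u"
    unfolding min_submod_norm_def f_def[symmetric]
    using u by (intro Least_equality) auto
  with u show ?thesis using that by (simp add: f_def)
qed

text \<open>The shifts 0 and 1 turn the restricted indicator into the indicator of
  \<open>S \<inter> h\<close> and minus the indicator of \<open>h - S \<inter> h\<close>; these give
  the two terms of the cut function.\<close>

lemma min_submod_norm_ind_vec_le:
  assumes F: "monotone_submodular h F"
  shows "min_submod_norm h F (ind_vec S) \<le> min (F (S \<inter> h)) (F (h - S \<inter> h))"
proof -
  obtain u where min: "\<And>v. min_submod_norm h F (ind_vec S)
      \<le> submod_norm h F (restrict_vec h (ind_vec S) - v *\<^sub>R ind_vec h)"
    using min_submod_norm_attained[OF F] by blast
  have "restrict_vec h (ind_vec S) - 0 *\<^sub>R ind_vec h = ind_vec (S \<inter> h)"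
    by (simp add: vec_eq_iff)
  then have "min_submod_norm h F (ind_vec S) \<le> F (S \<inter> h)"
    using min[of 0] submod_norm_ind_vec_le[OF F, of "S \<inter> h"] by simp
  moreover have "\<bar>restrict_vec h (ind_vec S) - 1 *\<^sub>R ind_vec h\<bar> = ind_vec (h - S \<inter> h)"
    by (simp add: vec_eq_iff)
  then have "min_submod_norm h F (ind_vec S) \<le> F (h - S \<inter> h)"
    using min[of 1] submod_norm_ind_vec_le[OF F, of "h - S \<inter> h"]
      submod_norm_abs[of h F "restrict_vec h (ind_vec S) - 1 *\<^sub>R ind_vec h"]
    by simp
  ultimately show ?thesis by simp
qed

section \<open>Flows and their demands\<close>

lemma dem_eq_sum:
  assumes "hypergraph_flow G Y"
  shows "dem G Y = (\<Sum>h\<in>hyperedges G. Y h)"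
proof -
  have "(\<Sum>h | h \<in> hyperedges G \<and> i \<in> h. Y h $ i) = (\<Sum>h\<in>hyperedges G. Y h $ i)" for i
    using assms
    by (intro sum.mono_neutral_left) (auto simp: hypergraph_flow_def vecs_on_def)
  then show ?thesis by (simp add: dem_def vec_eq_iff)
qed

text \<open>A zero-sum vector cannot see constants on \<open>h\<close>. This is what allows a
  different shift on each hyperedge.\<close>

lemma flow_inner_shift:
  assumes "y \<in> vecs_on h" "y \<bullet> ind_vec h = 0"
  shows "y \<bullet> (restrict_vec h x - u *\<^sub>R ind_vec h) = y \<bullet> x"
proof -
  have "y \<bullet> restrict_vec h x = y \<bullet> x"
    using assms(1) by (auto simp: inner_vec_def vecs_on_def intro!: sum.cong)
  then show ?thesis using assms(2) by (simp add: inner_diff_right)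
qed

lemma abs_inner_le: "\<bar>x \<bullet> y\<bar> \<le> \<bar>x\<bar> \<bullet> \<bar>y :: real ^ 'n::finite\<bar>"
  unfolding inner_vec_def by (rule order.trans[OF sum_abs]) (simp add: abs_mult)

text \<open>The hypothesis fixes the demand only up to signs at \<open>i\<close> and
  \<open>j\<close>; since the total demand is zero, the two signs are opposite when \<open>w\<close>
  is nonzero, and the difference of the entries of \<open>x\<close> appears.\<close>

lemma abs_inner_dem:
  assumes Y: "hypergraph_flow G Y" and "i \<noteq> j"
    and d: "\<bar>dem G Y\<bar> = w *\<^sub>R (ind_vec {i} + ind_vec {j})" and w: "0 \<le> w"
  shows "\<bar>dem G Y \<bullet> x\<bar> = w * \<bar>x $ i - x $ j\<bar>"
proof -
  let ?d = "dem G Y"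
  have abs_d: "\<bar>?d $ k\<bar> = w * ((if k = i then 1 else 0) + (if k = j then 1 else 0))" for k
    using arg_cong[OF d, of "\<lambda>v. v $ k"] by simp
  have expand: "?d \<bullet> z = ?d $ i * z $ i + ?d $ j * z $ j" for z
  proof -
    have "?d $ k = 0" if "k \<notin> {i, j}" for k
      using abs_d[of k] that by simp
    then have "?d \<bullet> z = (\<Sum>k\<in>{i, j}. ?d $ k * z $ k)"
      unfolding inner_vec_def inner_real_def
      by (intro sum.mono_neutral_right) auto
    then show ?thesis using \<open>i \<noteq> j\<close> by simp
  qed
  have "Y h \<bullet> ind_vec UNIV = 0" if "h \<in> hyperedges G" for h
  proof -
    \<comment> \<open>Shifting the all-ones vector by 1 annihilates it on \<open>h\<close>, so
      \<open>Y h\<close> has zero sum over all vertices.\<close>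
    have "restrict_vec h (ind_vec UNIV) - 1 *\<^sub>R ind_vec h = 0"
      by (simp add: vec_eq_iff)
    then show ?thesis
      using flow_inner_shift[of "Y h" h "ind_vec UNIV" 1] Y that
      by (simp add: hypergraph_flow_def)
  qed
  then have "?d \<bullet> ind_vec UNIV = 0"
    by (simp add: dem_eq_sum[OF Y] inner_sum_left)
  then have "?d $ j = - (?d $ i)" using expand by simp
  then have "?d \<bullet> x = ?d $ i * (x $ i - x $ j)"
    by (simp add: expand algebra_simps)
  then show ?thesis using abs_d[of i] \<open>i \<noteq> j\<close> by (simp add: abs_mult)
qed

section \<open>The norm inequality and its specialisation to cuts\<close>

lemma flow_embeds_norm_bound:
  assumes G: "monotone_submodular_hypergraph G" and H: "is_weighted_graph H"
    and emb: "flow_embeds H \<rho> G"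
  shows "(\<Sum>e\<in>edges H. eweight H e * edge_diff x e)
    \<le> \<rho> * (\<Sum>h\<in>hyperedges G. hweight G h * min_submod_norm h (cut_gen G h) x)"
proof -
  obtain Y where Y: "(\<forall>e\<in>edges H. hypergraph_flow G (Y e)) \<and>
      (\<forall>e\<in>edges H. \<forall>i j. e = {i, j} \<longrightarrow>
        \<bar>dem G (Y e)\<bar> = eweight H e *\<^sub>R (ind_vec {i} + ind_vec {j})) \<and>
      (\<forall>h\<in>hyperedges G.
        dual_norm h (cut_gen G h) (\<Sum>e\<in>edges H. \<bar>Y e h\<bar>) \<le> \<rho> * hweight G h)"
    using emb[unfolded flow_embeds_def, THEN conjunct2] ..
  have flow: "hypergraph_flow G (Y e)" if "e \<in> edges H" for e
    using Y that by simp
  have dem: "\<bar>dem G (Y e)\<bar> = eweight H e *\<^sub>R (ind_vec {i} + ind_vec {j})"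
    if "e \<in> edges H" "e = {i, j}" for e i j
    using Y that by simp
  have cong: "dual_norm h (cut_gen G h) (\<Sum>e\<in>edges H. \<bar>Y e h\<bar>) \<le> \<rho> * hweight G h"
    if "h \<in> hyperedges G" for h
    using Y that by simp
  have F: "monotone_submodular h (cut_gen G h)" if "h \<in> hyperedges G" for h
    using G that by (simp add: monotone_submodular_hypergraph_def)
  have "\<exists>u. min_submod_norm h (cut_gen G h) x
      = submod_norm h (cut_gen G h) (restrict_vec h x - u *\<^sub>R ind_vec h)"
    if "h \<in> hyperedges G" for h
    using min_submod_norm_attained[OF F[OF that]] by metis
  \<comment> \<open>One optimal shift is fixed per hyperedge, the same for all edges of
    \<open>H\<close>, so that the sum over edges can later be collected inside each
    hyperedge.\<close>
  then obtain u where u: "\<And>h. h \<in> hyperedges G \<Longrightarrow> min_submod_norm h (cut_gen G h) x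
      = submod_norm h (cut_gen G h) (restrict_vec h x - u h *\<^sub>R ind_vec h)"
    by metis
  define z where "z h = restrict_vec h x - u h *\<^sub>R ind_vec h" for h
  have edge: "eweight H e * edge_diff x e \<le> (\<Sum>h\<in>hyperedges G. \<bar>Y e h\<bar> \<bullet> \<bar>z h\<bar>)"
    if e: "e \<in> edges H" for e
  proof -
    have w: "0 \<le> eweight H e" and "card e = 2"
      using H e by (auto simp: is_weighted_graph_def)
    then obtain i j where ij: "e = {i, j}" "i \<noteq> j" by (meson card_2_iff)
    have "eweight H e * edge_diff x e = \<bar>dem G (Y e) \<bullet> x\<bar>"
      using abs_inner_dem[OF flow[OF e] ij(2) dem[OF e ij(1)] w] edge_diff_pair[of x i j] ij(1)
      by simp
    \<comment> \<open>The demand splits over hyperedges, and on each one \<open>x\<close> may be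
      replaced by its shifted restriction \<open>z h\<close>.\<close>
    also have "\<dots> = \<bar>\<Sum>h\<in>hyperedges G. Y e h \<bullet> z h\<bar>"
      using flow[OF e]
      by (simp add: dem_eq_sum inner_sum_left z_def flow_inner_shift hypergraph_flow_def)
    also have "\<dots> \<le> (\<Sum>h\<in>hyperedges G. \<bar>Y e h\<bar> \<bullet> \<bar>z h\<bar>)"
      by (rule order.trans[OF sum_abs sum_mono]) (rule abs_inner_le)
    finally show ?thesis .
  qed
  have hyperedge: "(\<Sum>e\<in>edges H. \<bar>Y e h\<bar>) \<bullet> \<bar>z h\<bar>
      \<le> \<rho> * (hweight G h * min_submod_norm h (cut_gen G h) x)" if h: "h \<in> hyperedges G" for h
  proof -
    \<comment> \<open>The duality inequality is applied to the entrywise absolute value, which has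
      the same norm as \<open>z h\<close>.\<close>
    have "\<bar>z h\<bar> \<in> vecs_on h" by (simp add: z_def vecs_on_def)
    then have "(\<Sum>e\<in>edges H. \<bar>Y e h\<bar>) \<bullet> \<bar>z h\<bar>
        \<le> submod_norm h (cut_gen G h) (z h) * dual_norm h (cut_gen G h) (\<Sum>e\<in>edges H. \<bar>Y e h\<bar>)"
      using inner_le_submod_norm_dual_norm[OF F[OF h]] by fastforce
    also have "\<dots> \<le> submod_norm h (cut_gen G h) (z h) * (\<rho> * hweight G h)"
      by (intro mult_left_mono cong[OF h] submod_norm_nonneg[OF F[OF h]])
    finally show ?thesis using u[OF h] by (simp add: z_def mult_ac)
  qed
  have "(\<Sum>e\<in>edges H. eweight H e * edge_diff x e)
      \<le> (\<Sum>e\<in>edges H. \<Sum>h\<in>hyperedges G. \<bar>Y e h\<bar> \<bullet> \<bar>z h\<bar>)"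
    by (intro sum_mono edge)
  also have "\<dots> = (\<Sum>h\<in>hyperedges G. (\<Sum>e\<in>edges H. \<bar>Y e h\<bar>) \<bullet> \<bar>z h\<bar>)"
    by (subst sum.swap) (simp add: inner_sum_left)
  also have "\<dots> \<le> (\<Sum>h\<in>hyperedges G. \<rho> * (hweight G h * min_submod_norm h (cut_gen G h) x))"
    by (intro sum_mono hyperedge)
  finally show ?thesis by (simp add: sum_distrib_left)
qed

text \<open>The indicator entries at the ends of an edge differ by 1 if the edge crosses
  \<open>S\<close> and by 0 otherwise.\<close>

lemma graph_cut_eq_sum_edge_diff:
  fixes H :: "('v::finite) weighted_graph"
  assumes H: "is_weighted_graph H"
  shows "graph_cut H S = (\<Sum>e\<in>edges H. eweight H e * edge_diff (ind_vec S) e)"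
proof -
  have "eweight H e * edge_diff (ind_vec S) e
      = (if e \<inter> S \<noteq> {} \<and> e - S \<noteq> {} then eweight H e else 0)" if "e \<in> edges H" for e
  proof -
    obtain i j where e: "e = {i, j}"
      using H \<open>e \<in> edges H\<close> by (auto simp: is_weighted_graph_def card_2_iff)
    show ?thesis unfolding e edge_diff_pair by auto
  qed
  then show ?thesis by (simp add: graph_cut_def sum.inter_filter)
qed

theorem mainTheorem6:
  fixes G :: "('v::finite) weighted_hypergraph" and H :: "'v weighted_graph" and \<rho> :: real
  assumes "monotone_submodular_hypergraph G"
    and "is_weighted_graph H"
    and "flow_embeds H \<rho> G"
  shows "(\<forall>x :: real ^ 'v.
            (\<Sum>e\<in>edges H. eweight H e * edge_diff x e)
              \<le> \<rho> * (\<Sum>h\<in>hyperedges G. hweight G h * min_submod_norm h (cut_gen G h) x)) \<and>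
         (\<forall>S :: 'v set. graph_cut H S \<le> \<rho> * hypergraph_cut G S)"
proof (intro conjI allI)
  show bound: "(\<Sum>e\<in>edges H. eweight H e * edge_diff x e)
      \<le> \<rho> * (\<Sum>h\<in>hyperedges G. hweight G h * min_submod_norm h (cut_gen G h) x)"
    for x :: "real ^ 'v"
    by (rule flow_embeds_norm_bound[OF assms])
  fix S :: "'v set"
  \<comment> \<open>Take \<open>x\<close> to be the indicator of \<open>S\<close>. Nonnegative
    weights carry the hyperedge bounds to the sum, and a nonnegative congestion carries that through
    the final product.\<close>
  have "0 \<le> \<rho>" using assms(3) by (simp add: flow_embeds_def)
  moreover have "(\<Sum>h\<in>hyperedges G. hweight G h * min_submod_norm h (cut_gen G h) (ind_vec S))
      \<le> hypergraph_cut G S"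
    unfolding hypergraph_cut_def hyperedge_cut_def
    using assms(1)
    by (intro sum_mono mult_left_mono min_submod_norm_ind_vec_le)
      (auto simp: monotone_submodular_hypergraph_def)
  ultimately show "graph_cut H S \<le> \<rho> * hypergraph_cut G S"
    unfolding graph_cut_eq_sum_edge_diff[OF assms(2)]
    by (rule order.trans[OF bound mult_left_mono[rotated]])
qed

end
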